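(* Consider a row of $n$ seats with a single entrance, filled by selfish theatregoers choosing seats according to the left-biased Zipf distribution (model described in the context). The expected number $L_n$ of occupied seats when the process ends is asymptotically $\ln\ln n$, i.e. $L_n/\ln\ln n\to1$ as $n\to\infty$.
   Context: Row model: a row of $n$ seats with a single entrance at one end. Theatregoers arrive one at a time; all are selfish: a seated theatregoer never gets up, so no later theatregoer can walk past her seat. An empty seat is accessible if it can be reached from the entrance without passing an occupied seat. When there are $m\ge1$ accessible empty seats, labelled $1,\dots,m$ in increasing order of distance from the entrance, the arriving theatregoer sits in the $k$-th one with probability $\frac{1}{kH_m}$, where $H_m=\sum_{i=1}^m\frac1i$ (left-biased Zipf distribution). The process ends when no accessible empty seat remains. *)

theory Defs
  imports "HOL-Probability.Probability" "HOL-Analysis.Harmonic_Numbers"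
begin

text \<open>Seats are numbered \<open>1, \<dots>, n\<close> by increasing distance from the entrance; a state of the
  process is the set \<open>S\<close> of occupied seats.\<close>

definition accessible_seats :: "nat \<Rightarrow> nat set \<Rightarrow> nat set" where
  "accessible_seats n S = {i \<in> {1..n}. i \<notin> S \<and> (\<forall>j\<in>S. \<not> j < i)}"

text \<open>Meaningful only for \<open>m \<ge> 1\<close>, where it is a probability distribution by \<open>pmf_zipf\<close> below;
  \<open>harm m\<close> is the harmonic number.\<close>

definition zipf_pmf :: "nat \<Rightarrow> nat pmf" where
  "zipf_pmf m = embed_pmf (\<lambda>k. if k \<in> {1..m} then 1 / (real k * harm m) else 0)"

definition kth_seat :: "nat set \<Rightarrow> nat \<Rightarrow> nat" where
  "kth_seat A k = sorted_list_of_set A ! (k - 1)"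

definition arrival :: "nat \<Rightarrow> nat set \<Rightarrow> nat set pmf" where
  "arrival n S =
    (let A = accessible_seats n S in
     if A = {} then return_pmf S
     else map_pmf (\<lambda>k. insert (kth_seat A k) S) (zipf_pmf (card A)))"

primrec occupied_after :: "nat \<Rightarrow> nat \<Rightarrow> nat set pmf" where
  "occupied_after n 0 = return_pmf {}"
| "occupied_after n (Suc t) = bind_pmf (occupied_after n t) (arrival n)"

text \<open>Every arrival before the end of the process occupies a new seat, so the process has ended
  after at most \<open>n\<close> arrivals (\<open>process_ended\<close> below), and \<open>arrival\<close> leaves ended states
  unchanged. Hence \<open>occupied_after n n\<close> is the distribution of the final set of occupied seats.\<close>

definition expected_occupied :: "nat \<Rightarrow> real" where
  "expected_occupied n = measure_pmf.expectation (occupied_after n n) (\<lambda>S. real (card S))"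

lemma pmf_zipf:
  assumes "m \<ge> 1"
  shows "pmf (zipf_pmf m) k = (if k \<in> {1..m} then 1 / (real k * harm m) else 0)"
proof -
  let ?f = "\<lambda>k. if k \<in> {1..m} then 1 / (real k * harm m) else (0::real)"
  have pos: "harm m > (0::real)" using assms by (simp add: harm_pos_iff)
  have nn: "?f k \<ge> 0" for k using harm_nonneg[of m, where ?'a=real] by simp
  have "(\<integral>\<^sup>+k. ennreal (?f k) \<partial>count_space UNIV) = (\<Sum>k\<in>{1..m}. ennreal (?f k))"
    by (intro nn_integral_count_space') auto
  also have "\<dots> = ennreal (\<Sum>k\<in>{1..m}. ?f k)"
    by (rule sum_ennreal) (rule nn)
  also have "(\<Sum>k\<in>{1..m}. ?f k) = (\<Sum>k\<in>{1..m}. inverse (real k)) / harm m"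
    by (simp add: sum_divide_distrib divide_simps)
  also have "\<dots> = 1" using pos by (simp add: harm_def)
  finally have "(\<integral>\<^sup>+k. ennreal (?f k) \<partial>count_space UNIV) = 1" by simp
  with nn show ?thesis unfolding zipf_pmf_def by (intro pmf_embed_pmf) auto
qed

lemma set_pmf_zipf:
  assumes "m \<ge> 1"
  shows "set_pmf (zipf_pmf m) = {1..m}"
proof -
  have "harm m > (0::real)" using assms by (simp add: harm_pos_iff)
  then have "harm m \<noteq> (0::real)" by linarith
  then show ?thesis by (auto simp: set_pmf_eq pmf_zipf[OF assms])
qed

lemma finite_accessible_seats: "finite (accessible_seats n S)"
  by (simp add: accessible_seats_def)

lemma kth_seat_mem:
  assumes "finite A" "k \<in> {1..card A}"
  shows "kth_seat A k \<in> A"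
proof -
  have "sorted_list_of_set A ! (k - 1) \<in> set (sorted_list_of_set A)"
    using assms by (intro nth_mem) auto
  with assms(1) show ?thesis by (simp add: kth_seat_def)
qed

lemma occupied_after_invariant:
  "S \<in> set_pmf (occupied_after n t) \<Longrightarrow>
     S \<subseteq> {1..n} \<and> (accessible_seats n S = {} \<or> card S = t)"
proof (induction t arbitrary: S)
  case 0
  then show ?case by simp
next
  case (Suc t)
  then obtain T where T: "T \<in> set_pmf (occupied_after n t)" and S: "S \<in> set_pmf (arrival n T)"
    by auto
  note IH = Suc.IH[OF T]
  let ?A = "accessible_seats n T"
  show ?case
  proof (cases "?A = {}")
    case True
    with S IH show ?thesis by (simp add: arrival_def)
  next
    case False
    then have "card ?A \<ge> 1"
      using finite_accessible_seats[of n T] by (simp add: Suc_le_eq card_gt_0_iff)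
    with S False have "S \<in> (\<lambda>k. insert (kth_seat ?A k) T) ` {1..card ?A}"
      by (simp add: arrival_def Let_def set_pmf_zipf)
    then obtain k where k: "k \<in> {1..card ?A}" and Sk: "S = insert (kth_seat ?A k) T"
      by blast
    have "kth_seat ?A k \<in> ?A"
      using kth_seat_mem[OF finite_accessible_seats k] .
    moreover have "finite T" using IH finite_subset by blast
    ultimately show ?thesis
      using IH False unfolding Sk by (auto simp: accessible_seats_def)
  qed
qed

lemma process_ended:
  assumes "S \<in> set_pmf (occupied_after n n)"
  shows "accessible_seats n S = {}"
proof (rule ccontr)
  assume ne: "accessible_seats n S \<noteq> {}"
  with occupied_after_invariant[OF assms] have "S \<subseteq> {1..n}" "card S = n" by auto
  then have "S = {1..n}" by (intro card_subset_eq) auto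
  with ne show False by (auto simp: accessible_seats_def)
qed

end

theory Submission
  imports Defs "HOL-Real_Asymp.Real_Asymp"
begin

text \<open>Put \<open>g m = (\<Sum>k=1..m. 1 / (k H\<^sub>k))\<close>. Partial summation gives
  \<open>H\<^sub>m g m = H\<^sub>m + (\<Sum>k=1..m. g (k - 1) / k)\<close>. Since taking the \<open>k\<close>-th of \<open>m\<close> accessible seats
  leaves exactly \<open>k - 1\<close> accessible ones, this says that the number of occupied seats plus \<open>g\<close> of
  the number of accessible seats is a martingale; hence \<open>L\<^sub>n = g n\<close>. Comparing the increments
  \<open>1 / (k H\<^sub>k)\<close> with those of \<open>ln H\<^sub>k\<close> shows \<open>ln H\<^sub>n \<le> g n \<le> 1 + ln H\<^sub>n\<close>, and \<open>H\<^sub>n \<sim> ln n\<close>.\<close>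

section \<open>The sum \<open>harm_recip_sum\<close>: its identity, bounds and growth\<close>

definition harm_recip_sum :: "nat \<Rightarrow> real" where
  "harm_recip_sum m = (\<Sum>k=1..m. 1 / (real k * harm k))"

lemma harm_recip_sum_0 [simp]: "harm_recip_sum 0 = 0"
  by (simp add: harm_recip_sum_def)

lemma harm_recip_sum_Suc:
  "harm_recip_sum (Suc m) = harm_recip_sum m + 1 / (real (Suc m) * harm (Suc m))"
  by (simp add: harm_recip_sum_def)

text \<open>Divided by \<open>harm m\<close>, this is a one-step recursion: under the Zipf law on
  \<open>{1..m}\<close>, the mean of \<open>1 + harm_recip_sum (k - 1)\<close> is
  \<open>harm_recip_sum m\<close>.\<close>

lemma harm_mult_harm_recip_sum:
  "harm m * harm_recip_sum m = harm m + (\<Sum>k=1..m. harm_recip_sum (k - 1) / real k)"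
proof (induction m)
  case 0
  show ?case by (simp add: harm_def)
next
  case (Suc m)
  have "harm (Suc m) \<noteq> (0::real)"
    using harm_pos[of "Suc m", where ?'a = real] by linarith
  then have "harm (Suc m) * harm_recip_sum (Suc m)
      = harm (Suc m) * harm_recip_sum m + 1 / real (Suc m)"
    by (simp add: harm_recip_sum_Suc distrib_left)
  also have "harm (Suc m) * harm_recip_sum m
      = harm m * harm_recip_sum m + harm_recip_sum m / real (Suc m)"
    by (simp add: harm_Suc divide_inverse algebra_simps)
  finally show ?case
    using Suc.IH by (simp add: harm_Suc inverse_eq_divide)
qed

text \<open>The term \<open>1 / real n\<close> makes the lower bound inductive: an increment of
  \<open>ln (harm k)\<close> can exceed \<open>1 / (k * harm k)\<close>, but only by at most
  \<open>1 / (k - 1) - 1 / k\<close>, and these errors telescope. At \<open>n = 1\<close> both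
  bounds are equalities.\<close>

lemma harm_recip_sum_bounds:
  assumes "n \<ge> 1"
  shows "ln (harm n) + 1 / real n \<le> harm_recip_sum n \<and> harm_recip_sum n \<le> 1 + ln (harm n)"
  using assms
proof (induction n rule: dec_induct)
  case base
  show ?case by (simp add: harm_recip_sum_def harm_def)
next
  case (step n)
  define h :: real where "h = harm n"
  define h' :: real where "h' = harm (Suc n)"
  define a :: real where "a = real (Suc n)"
  have a: "a \<ge> 2" using step.hyps by (simp add: a_def)
  have h1: "h \<ge> 1"
    using harm_mono[of 1 n, where ?'a = real] step.hyps by (simp add: h_def harm_def)
  have h': "h' = h + 1 / a"
    by (simp add: h'_def h_def a_def harm_Suc inverse_eq_divide)
  have h'1: "h' \<ge> 1" using h1 a h' by (simp add: add_increasing2)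
  have g: "harm_recip_sum (Suc n) = harm_recip_sum n + 1 / (a * h')"
    by (simp add: harm_recip_sum_Suc a_def h'_def)
  have "ln (h' / h) \<le> h' / h - 1"
    using h1 h'1 by (intro ln_le_minus_one) simp
  also have "h' / h - 1 = 1 / (a * h)"
    using h1 a by (simp add: h' field_simps)
  also have "\<dots> = 1 / (a * h') + 1 / (a\<^sup>2 * (h * h'))"
  proof -
    have "1 / (a * h) - 1 / (a * h') = (h' - h) / (a * (h * h'))"
      using h1 h'1 a by (simp add: field_simps)
    also have "\<dots> = 1 / (a\<^sup>2 * (h * h'))"
      by (simp add: h' power2_eq_square)
    finally show ?thesis by simp
  qed
  \<comment> \<open>Here \<open>h * h' \<ge> 1\<close> removes the harmonic numbers, and weakening
    \<open>a\<^sup>2\<close> to \<open>a * (a - 1)\<close> gives a telescoping difference.\<close>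
  also have "1 / (a\<^sup>2 * (h * h')) \<le> 1 / (a * (a - 1))"
  proof (rule divide_left_mono)
    have "a * (a - 1) \<le> a\<^sup>2 * 1" using a by (simp add: power2_eq_square)
    also have "\<dots> \<le> a\<^sup>2 * (h * h')"
      using mult_mono[OF h1 h'1] h1 by (intro mult_left_mono) auto
    finally show "a * (a - 1) \<le> a\<^sup>2 * (h * h')" .
    show "0 < a\<^sup>2 * (h * h') * (a * (a - 1))" using a h1 h'1 by simp
  qed simp
  also have "1 / (a * (a - 1)) = 1 / (a - 1) - 1 / a"
    using a by (simp add: field_simps)
  finally have low: "ln (h' / h) \<le> 1 / (a * h') + (1 / (a - 1) - 1 / a)" by simp
  \<comment> \<open>The same inequality \<open>ln x \<le> x - 1\<close>, now at the reciprocal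
    ratio, bounds the increment of \<open>ln (harm n)\<close> from below, as the upper bound
    requires.\<close>
  have "ln (h / h') \<le> h / h' - 1"
    using h1 h'1 by (intro ln_le_minus_one) simp
  also have "\<dots> = - (1 / (a * h'))"
  proof -
    have "h / h' - 1 = (h - h') / h'" using h'1 by (simp add: field_simps)
    also have "\<dots> = - (1 / (a * h'))" by (simp add: h')
    finally show ?thesis .
  qed
  finally have up: "ln (h / h') \<le> - (1 / (a * h'))" .
  have "ln (h' / h) = ln h' - ln h" "ln (h / h') = ln h - ln h'"
    using h1 h'1 by (simp_all add: ln_div)
  moreover have "real n = a - 1" by (simp add: a_def)
  ultimately show ?case
    using step.IH low up g unfolding h_def[symmetric] h'_def[symmetric] a_def[symmetric]
    by simp
qed

text \<open>Each new term \<open>1 / (n + 1)\<close> is at most \<open>ln (n + 1) - ln n\<close>, by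
  \<open>ln x \<le> x - 1\<close> at \<open>x = n / (n + 1)\<close>.\<close>

lemma harm_le_one_plus_ln:
  assumes "n \<ge> 1"
  shows "harm n \<le> 1 + ln (real n)"
  using assms
proof (induction n rule: dec_induct)
  case base
  show ?case by (simp add: harm_def)
next
  case (step n)
  have "ln (real n / real (Suc n)) \<le> real n / real (Suc n) - 1"
    using step.hyps by (intro ln_le_minus_one) simp
  also have "\<dots> = - inverse (real (Suc n))"
    by (simp add: field_simps)
  finally have "inverse (real (Suc n)) \<le> ln (real (Suc n)) - ln (real n)"
    using step.hyps by (simp add: ln_div)
  with step.IH show ?case by (simp add: harm_Suc)
qed

lemma harm_recip_sum_asymp:
  "(\<lambda>n. harm_recip_sum n / ln (ln (real n))) \<longlonglongrightarrow> 1"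
proof (rule tendsto_sandwich)
  \<comment> \<open>Positivity of \<open>ln (ln n)\<close> lets the bounds be divided by it.\<close>
  have ev: "\<forall>\<^sub>F n::nat in sequentially. n \<ge> 1 \<and> ln (real n) > 0 \<and> ln (ln (real n)) > 0"
    by (intro eventually_conj eventually_ge_at_top) real_asymp+
  have bnd: "ln (ln (real n)) \<le> harm_recip_sum n \<and> harm_recip_sum n \<le> 1 + ln (1 + ln (real n))"
    if n: "n \<ge> 1" "ln (real n) > 0" for n
  proof -
    have "ln (real n) \<le> ln (real n + 1)" using n by simp
    also have "\<dots> \<le> harm n" by (rule ln_le_harm)
    finally have "ln (ln (real n)) \<le> ln (harm n)" using n by simp
    moreover have "ln (harm n) \<le> ln (1 + ln (real n))"
      using harm_le_one_plus_ln[OF n(1)] n by (intro ln_mono) (auto simp: harm_pos_iff)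
    moreover have "1 / real n \<ge> 0" by simp
    ultimately show ?thesis using harm_recip_sum_bounds[OF n(1)] by linarith
  qed
  show "\<forall>\<^sub>F n in sequentially. 1 \<le> harm_recip_sum n / ln (ln (real n))"
    using ev by eventually_elim (use bnd in \<open>simp del: ln_gt_zero_iff\<close>)
  show "\<forall>\<^sub>F n in sequentially.
      harm_recip_sum n / ln (ln (real n)) \<le> (1 + ln (1 + ln (real n))) / ln (ln (real n))"
    using ev by eventually_elim (meson bnd divide_right_mono less_imp_le)
  show "(\<lambda>n. (1 + ln (1 + ln (real n))) / ln (ln (real n))) \<longlonglongrightarrow> 1"
    by real_asymp
qed simp

section \<open>The shape of the accessible set\<close>

text \<open>Every seat nearer to the entrance than an accessible one is itself accessible, so the
  set is an initial segment. Hence its cardinality determines it, and its \<open>k\<close>-th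
  element is simply \<open>k\<close>.\<close>

lemma accessible_seats_eq: "accessible_seats n S = {1..card (accessible_seats n S)}"
proof (cases "accessible_seats n S = {}")
  case False
  define m where "m = Max (accessible_seats n S)"
  have "m \<in> accessible_seats n S"
    unfolding m_def using False finite_accessible_seats by (rule Max_in[rotated])
  moreover have "i \<le> m" if "i \<in> accessible_seats n S" for i
    unfolding m_def using finite_accessible_seats that by (rule Max_ge)
  ultimately have "accessible_seats n S = {1..m}"
    by (fastforce simp: accessible_seats_def)
  then show ?thesis by simp
qed simp

lemma accessible_seats_insert:
  assumes "k \<in> {1..card (accessible_seats n S)}"
  shows "accessible_seats n (insert k S) = {1..k - 1}"
proof -
  have "accessible_seats n (insert k S) = {i \<in> accessible_seats n S. i < k}"
    by (auto simp: accessible_seats_def)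
  also have "\<dots> = {1..k - 1}"
    using assms by (subst accessible_seats_eq) auto
  finally show ?thesis .
qed

lemma kth_seat_atLeastAtMost:
  assumes "k \<in> {1..m}"
  shows "kth_seat {1..m} k = k"
proof -
  have "sorted_list_of_set {1..m} = [1..<Suc m]"
    by (metis atLeastLessThanSuc_atLeastAtMost sorted_list_of_set_range)
  then show ?thesis using assms by (simp add: kth_seat_def del: upt_Suc)
qed

section \<open>The martingale and the expected number of occupied seats\<close>

text \<open>Seats already taken plus the expected number still to be taken.\<close>

definition potential :: "nat \<Rightarrow> nat set \<Rightarrow> real" where
  "potential n S = real (card S) + harm_recip_sum (card (accessible_seats n S))"

lemma finite_set_pmf_arrival: "finite (set_pmf (arrival n S))"
proof (cases "accessible_seats n S = {}")
  case False
  then have "card (accessible_seats n S) \<ge> 1"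
    using finite_accessible_seats[of n S] by (simp add: Suc_le_eq card_gt_0_iff)
  with False show ?thesis by (simp add: arrival_def Let_def set_pmf_zipf)
qed (simp add: arrival_def)

lemma expectation_potential_arrival:
  assumes "finite S"
  shows "measure_pmf.expectation (arrival n S) (potential n) = potential n S"
proof (cases "accessible_seats n S = {}")
  case True
  then show ?thesis by (simp add: arrival_def)
next
  case False
  define m where "m = card (accessible_seats n S)"
  have A: "accessible_seats n S = {1..m}"
    unfolding m_def by (rule accessible_seats_eq)
  have m: "m \<ge> 1" using False A by auto
  have "harm m > (0::real)" using m by (simp add: harm_pos_iff)
  then have H: "harm m \<noteq> (0::real)" by linarith
  \<comment> \<open>Sitting in seat \<open>k\<close> adds one occupied seat and leaves the
    \<open>k - 1\<close> seats before it accessible.\<close>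
  have pot: "potential n (insert (kth_seat {1..m} k) S)
      = real (card S) + 1 + harm_recip_sum (k - 1)" if k: "k \<in> {1..m}" for k
  proof -
    have "k \<notin> S" using k A unfolding accessible_seats_def by blast
    moreover have "accessible_seats n (insert k S) = {1..k - 1}"
      using k unfolding m_def by (rule accessible_seats_insert)
    ultimately show ?thesis
      using assms unfolding potential_def kth_seat_atLeastAtMost[OF k] by simp
  qed
  have "measure_pmf.expectation (arrival n S) (potential n)
      = measure_pmf.expectation (zipf_pmf m) (\<lambda>k. potential n (insert (kth_seat {1..m} k) S))"
    using False by (simp add: arrival_def A m)
  also have "\<dots> = (\<Sum>k\<in>{1..m}. pmf (zipf_pmf m) k *\<^sub>R potential n (insert (kth_seat {1..m} k) S))"
    by (rule integral_measure_pmf) (auto simp: set_pmf_zipf[OF m])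
  also have "\<dots> = (\<Sum>k\<in>{1..m}. ((real (card S) + 1) * inverse (real k)
      + harm_recip_sum (k - 1) / real k) / harm m)"
  proof (intro sum.cong refl)
    fix k assume k: "k \<in> {1..m}"
    then have "pmf (zipf_pmf m) k = 1 / (real k * harm m)" by (simp add: pmf_zipf[OF m])
    then show "pmf (zipf_pmf m) k *\<^sub>R potential n (insert (kth_seat {1..m} k) S)
        = ((real (card S) + 1) * inverse (real k) + harm_recip_sum (k - 1) / real k) / harm m"
      unfolding pot[OF k] by (simp add: divide_inverse algebra_simps)
  qed
  also have "\<dots> = ((real (card S) + 1) * harm m
      + (\<Sum>k\<in>{1..m}. harm_recip_sum (k - 1) / real k)) / harm m"
    by (simp add: sum.distrib sum_distrib_left harm_def flip: sum_divide_distrib)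
  \<comment> \<open>The extra \<open>harm m\<close>, contributed by the newly occupied seat, is
    exactly the one in \<open>harm_mult_harm_recip_sum\<close>.\<close>
  also have "\<dots> = (real (card S) * harm m + harm m * harm_recip_sum m) / harm m"
    by (simp add: harm_mult_harm_recip_sum algebra_simps)
  also have "\<dots> = potential n S"
    using H by (simp add: potential_def add_divide_distrib flip: m_def)
  finally show ?thesis .
qed

lemma expectation_potential_occupied_after:
  "measure_pmf.expectation (occupied_after n t) (potential n) = harm_recip_sum n"
proof (induction t)
  case 0
  have "accessible_seats n {} = {1..n}" by (auto simp: accessible_seats_def)
  then show ?case by (simp add: potential_def)
next
  case (Suc t)
  \<comment> \<open>All reachable states lie in one finite family, so expectations become finite
    sums and the one-step identity applies termwise.\<close>
  have sub: "set_pmf (occupied_after n t) \<subseteq> Pow {1..n}"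
    using occupied_after_invariant by blast
  have "measure_pmf.expectation (occupied_after n (Suc t)) (potential n)
      = (\<Sum>S\<in>Pow {1..n}. pmf (occupied_after n t) S *\<^sub>R
          measure_pmf.expectation (arrival n S) (potential n))"
    unfolding occupied_after.simps
    by (rule pmf_expectation_bind) (use sub finite_set_pmf_arrival in auto)
  also have "\<dots> = (\<Sum>S\<in>Pow {1..n}. pmf (occupied_after n t) S *\<^sub>R potential n S)"
    by (intro sum.cong refl arg_cong2[where f = scaleR] expectation_potential_arrival)
      (auto intro: finite_subset)
  also have "\<dots> = measure_pmf.expectation (occupied_after n t) (potential n)"
    by (rule integral_measure_pmf[symmetric]) (use sub in auto)
  finally show ?case using Suc.IH by simp
qed

text \<open>In an ended state the second summand of the potential is
  \<open>harm_recip_sum 0 = 0\<close>, so on the support of the final distribution the potential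
  equals \<open>card S\<close>.\<close>

lemma expected_occupied_eq: "expected_occupied n = harm_recip_sum n"
proof -
  have "expected_occupied n = measure_pmf.expectation (occupied_after n n) (potential n)"
    unfolding expected_occupied_def
    by (intro integral_cong_AE)
      (auto simp: AE_measure_pmf_iff potential_def dest: process_ended)
  then show ?thesis by (simp add: expectation_potential_occupied_after)
qed

theorem theorem7:
  "(\<lambda>n. expected_occupied n / ln (ln (real n))) \<longlonglongrightarrow> 1"
  using harm_recip_sum_asymp by (simp add: expected_occupied_eq)

end
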